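(* Let $p$ be an odd prime, let $m\ge 2$ be an integer, let $q=p^m$, and let $0<i<m$ be an integer. If $\gcd(i,m)=\gcd(i,2m)$, then the polynomial $$F(x)=x^2 + x^{q+1} - x^{(q+1)p^i} + x^{2qp^i}\in\mathbb{F}_{q^2}[x]$$ is a planar Dembowski–Ostrom (DO) polynomial over $\mathbb{F}_{q^2}$ representing the Dickson semifield with parameter $i$; that is, the commutative presemifield $(\mathbb{F}_{q^2},+,\star_F)$ with $x\star_F y=F(x+y)-F(x)-F(y)$ is isotopic to the Dickson commutative semifield $(\mathbb{F}_{p^m}^2,+,\star)$ given by $(a,b)\star(c,d)=(ac+\alpha (bd)^{p^i},\,ad+bc)$ for all $a,b,c,d\in\mathbb{F}_{p^m}$, where $\alpha\in\mathbb{F}_{p^m}$ is a nonsquare.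
   Context: A function $F:\mathbb{F}_{p^n}\to\mathbb{F}_{p^n}$ ($p$ odd) is planar if for every $a\in\mathbb{F}_{p^n}\setminus\{0\}$ the map $x\mapsto F(x+a)-F(x)$ is a bijection of $\mathbb{F}_{p^n}$. A DO polynomial over $\mathbb{F}_{p^n}$ is a polynomial of the form $\sum_{0\le k\le j<n}\alpha_{k,j}x^{p^j+p^k}$ with $\alpha_{k,j}\in\mathbb{F}_{p^n}$ (every monomial has algebraic degree exactly 2). A presemifield is a set with two binary operations $+,\star$ such that $(S,+)$ is an abelian group, $\star$ is left and right distributive over $+$, and $a\star b=0$ implies $a=0$ or $b=0$. Two presemifields $(\mathbb{F}_{q'},+,\star)$ and $(\mathbb{F}_{q'},+,* )$ (identified via additive isomorphism) are isotopic if there are linear ($\mathbb{F}_p$-linear) permutations $L,M,N$ with $L(x\star y)=M(x)*N(y)$ for all $x,y$. For a planar DO polynomial $F$, $x\star_F y=F(x+y)-F(x)-F(y)$ defines a commutative presemifield. For fixed $i$, all nonsquares $\alpha$ give isotopic Dickson semifields. *)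

theory Defs
  imports
    "HOL-Computational_Algebra.Polynomial"
    "HOL-Computational_Algebra.Primes"
    "HOL-Library.Cardinality"
    "HOL-Library.Product_Plus"
begin

definition planar :: "('a :: {field, finite} \<Rightarrow> 'a) \<Rightarrow> bool" where
  "planar F \<longleftrightarrow> (\<forall>a. a \<noteq> 0 \<longrightarrow> bij (\<lambda>x. F (x + a) - F x))"

text \<open>Here \<open>p\<close> and \<open>n\<close> are such that the coefficient field has \<open>p ^ n\<close> elements.\<close>

definition DO_poly :: "nat \<Rightarrow> nat \<Rightarrow> 'a :: {field, finite} poly \<Rightarrow> bool" where
  "DO_poly p n f \<longleftrightarrow>
     (\<exists>\<alpha> :: nat \<Rightarrow> nat \<Rightarrow> 'a. f = (\<Sum>j<n. \<Sum>k\<le>j. monom (\<alpha> k j) (p ^ j + p ^ k)))"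

text \<open>The additive group of a presemifield is that of the carrier type, so only the
  multiplication is an argument.\<close>

definition presemifield :: "('a :: ab_group_add \<Rightarrow> 'a \<Rightarrow> 'a) \<Rightarrow> bool" where
  "presemifield s \<longleftrightarrow>
     (\<forall>x y z. s x (y + z) = s x y + s x z) \<and>
     (\<forall>x y z. s (x + y) z = s x z + s y z) \<and>
     (\<forall>x y. s x y = 0 \<longrightarrow> x = 0 \<or> y = 0)"

definition commutative_presemifield :: "('a :: ab_group_add \<Rightarrow> 'a \<Rightarrow> 'a) \<Rightarrow> bool" where
  "commutative_presemifield s \<longleftrightarrow> presemifield s \<and> (\<forall>x y. s x y = s y x)"

definition commutative_semifield :: "('a :: ab_group_add \<Rightarrow> 'a \<Rightarrow> 'a) \<Rightarrow> bool" where
  "commutative_semifield s \<longleftrightarrow>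
     commutative_presemifield s \<and> (\<exists>e. e \<noteq> 0 \<and> (\<forall>x. s e x = x \<and> s x e = x))"

text \<open>The scalar \<open>k mod p\<close> of the prime field acts on an elementary abelian \<open>p\<close>-group
  as the \<open>k\<close>-fold sum; this makes sense uniformly for a field and for pairs over a field.\<close>

definition prime_field_scale :: "nat \<Rightarrow> 'a :: comm_monoid_add \<Rightarrow> 'a" where
  "prime_field_scale k x = (\<Sum>_<k. x)"

definition prime_field_linear :: "('a :: ab_group_add \<Rightarrow> 'b :: ab_group_add) \<Rightarrow> bool" where
  "prime_field_linear L \<longleftrightarrow>
     (\<forall>x y. L (x + y) = L x + L y) \<and>
     (\<forall>k x. L (prime_field_scale k x) = prime_field_scale k (L x))"

text \<open>The two additive groups need not live on the same type, so the linear permutations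
  become linear bijections between the two types.\<close>

definition isotopic ::
    "('a :: ab_group_add \<Rightarrow> 'a \<Rightarrow> 'a) \<Rightarrow> ('b :: ab_group_add \<Rightarrow> 'b \<Rightarrow> 'b) \<Rightarrow> bool" where
  "isotopic s t \<longleftrightarrow>
     (\<exists>L M N :: 'a \<Rightarrow> 'b.
        prime_field_linear L \<and> bij L \<and>
        prime_field_linear M \<and> bij M \<and>
        prime_field_linear N \<and> bij N \<and>
        (\<forall>x y. L (s x y) = t (M x) (N y)))"

definition planar_star :: "('a :: ab_group_add \<Rightarrow> 'a) \<Rightarrow> 'a \<Rightarrow> 'a \<Rightarrow> 'a" where
  "planar_star F x y = F (x + y) - F x - F y"

definition dickson_star ::
    "nat \<Rightarrow> nat \<Rightarrow> 'b :: field \<Rightarrow> 'b \<times> 'b \<Rightarrow> 'b \<times> 'b \<Rightarrow> 'b \<times> 'b" where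
  "dickson_star p i \<alpha> = (\<lambda>(a, b) (c, d). (a * c + \<alpha> * (b * d) ^ (p ^ i), a * d + b * c))"

end

theory Submission
  imports "HOL-Number_Theory.Residues" Defs
begin

text \<open>
  Write \<open>x = u + w\<close> with \<open>u\<close> in the subfield \<open>K\<close> of order \<open>q\<close> and \<open>w = b \<omega>\<close>, where
  \<open>b \<in> K\<close> and \<open>\<omega> ^ q = - \<omega>\<close>; put \<open>\<sigma> = p ^ i\<close>. Then
  \<open>F x = 2 (u\<^sup>2 + (w\<^sup>2)^\<sigma>) + 2 (T (u w))\<close> with \<open>T z = z - z^\<sigma>\<close>, and the two summands lie in
  \<open>K\<close> and in \<open>K \<omega>\<close>. The fixed points of \<open>z \<mapsto> z^\<sigma>\<close> form the subfield of order
  \<open>p ^ gcd i (2 m)\<close>, which the gcd condition places inside \<open>K\<close>; hence \<open>T\<close> is bijective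
  on \<open>K \<omega>\<close>, and polarizing \<open>F\<close> gives the Dickson product with \<open>\<alpha> = (\<omega>\<^sup>2)^\<sigma>\<close>. Every nonsquare
  \<open>\<alpha>\<close> is reached by choosing \<open>\<omega>\<close>, and planarity follows from the isotopy because Dickson's
  multiplication has no zero divisors.
  The type \<open>'b\<close> is identified with \<open>K\<close> by sending a generator of its multiplicative group
  to a root in \<open>K\<close> of the minimal polynomial of that generator over the prime field; integer
  polynomials that are monic stand in for polynomials over the prime field.
\<close>

section \<open>Multiplicative group and characteristic of a finite field\<close>

text \<open>Multiplication by \<open>x\<close> permutes the nonzero elements, so their product
  absorbs the factor \<open>x ^ (CARD('a) - 1)\<close>.\<close>

lemma finite_field_power_card_minus_1:
  fixes x :: "'a :: {field, finite}"
  assumes "x \<noteq> 0"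
  shows "x ^ (CARD('a) - 1) = 1"
proof -
  have "(\<Prod>y\<in>UNIV-{0}. y) = (\<Prod>y\<in>UNIV-{0}. x * y)"
    by (rule prod.reindex_bij_witness[of _ "\<lambda>y. x * y" "\<lambda>y. y / x"]) (use assms in auto)
  also have "\<dots> = x ^ (CARD('a) - 1) * (\<Prod>y\<in>UNIV-{0}. y)"
    by (simp add: prod.distrib card_Diff_subset)
  finally show ?thesis
    by (simp add: prod_zero_iff)
qed

lemma finite_field_power_card:
  fixes x :: "'a :: {field, finite}"
  shows "x ^ CARD('a) = x"
proof (cases "x = 0")
  case False
  have "x ^ CARD('a) = x * x ^ (CARD('a) - 1)"
    by (metis power_minus_mult mult.commute zero_less_card_finite)
  thus ?thesis using finite_field_power_card_minus_1[OF False] by simp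
qed simp

text \<open>Cyclicity is transferred from the algebraic structure \<open>R\<close> built on the
  whole type. The exact order follows by counting: if \<open>g ^ k = 1\<close> with
  \<open>k > 0\<close>, then the powers with exponent below \<open>k\<close> already exhaust the
  nonzero elements.\<close>

lemma finite_field_generator:
  obtains g :: "'a :: {field, finite}"
  where "g \<noteq> 0" "\<And>x. x \<noteq> 0 \<Longrightarrow> \<exists>k. x = g ^ k"
        "\<And>k. g ^ k = 1 \<longleftrightarrow> (CARD('a) - 1) dvd k"
proof -
  define R :: "'a ring"
    where "R = \<lparr>carrier = UNIV, monoid.mult = (*), one = 1, ring.zero = 0, add = (+)\<rparr>"
  have neg: "\<exists>y. x + y = 0" for x :: 'a
    using add.right_inverse by blast
  have inv: "x \<noteq> 0 \<Longrightarrow> \<exists>y. x * y = 1" for x :: 'a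
    by (rule exI[of _ "inverse x"]) auto
  interpret R: Ring.field R
    unfolding R_def using neg inv by unfold_locales (auto simp: algebra_simps Units_def)
  have pow: "x [^]\<^bsub>R\<^esub> k = x ^ k" for x and k :: nat
    by (induction k) (simp_all add: R_def)
  have fin: "finite (carrier R)"
    by (simp add: R_def)
  have carr: "carrier (mult_of R) = UNIV - {0}"
    by (simp add: R_def)
  have "\<exists>a\<in>UNIV - {0 :: 'a}. UNIV - {0} = {a ^ k |k. k \<in> (UNIV :: nat set)}"
    using R.finite_field_mult_group_has_gen[OF fin] unfolding carr pow .
  then obtain g where g0: "g \<in> UNIV - {0 :: 'a}"
    and gens: "UNIV - {0} = {g ^ k |k. k \<in> (UNIV :: nat set)}" ..
  have g: "g \<noteq> 0" using g0 by simp
  have gen: "\<exists>k. x = g ^ k" if "x \<noteq> 0" for x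
  proof -
    have "x \<in> {g ^ k |k. k \<in> (UNIV :: nat set)}" unfolding gens[symmetric] using that by simp
    thus ?thesis by simp
  qed
  have g1: "g ^ (CARD('a) - 1) = 1"
    using finite_field_power_card_minus_1[OF g] .
  have mod: "g ^ (l mod k) = g ^ l" if "g ^ k = 1" for k l
  proof -
    have "g ^ l = g ^ (k * (l div k) + l mod k)" by simp
    also have "\<dots> = g ^ (l mod k)" using that by (simp only: power_add power_mult) simp
    finally show ?thesis by simp
  qed
  have le: "CARD('a) - 1 \<le> k" if "g ^ k = 1" "k > 0" for k
  proof -
    have "x \<in> (\<lambda>l. g ^ l) ` {..<k}" if "x \<noteq> 0" for x
    proof -
      from that obtain l where "x = g ^ l" using gen by blast
      thus ?thesis using mod[OF \<open>g ^ k = 1\<close>, of l] \<open>k > 0\<close>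
        by (intro image_eqI[of _ _ "l mod k"]) auto
    qed
    hence "UNIV - {0} \<subseteq> (\<lambda>l. g ^ l) ` {..<k}" by blast
    hence "card (UNIV - {0 :: 'a}) \<le> card {..<k}"
      by (intro surj_card_le) simp_all
    thus ?thesis by (simp add: card_Diff_subset)
  qed
  have "1 < CARD('a)"
    using card_mono[of UNIV "{0, 1 :: 'a}"] by simp
  hence "k mod (CARD('a) - 1) < CARD('a) - 1" for k by simp
  hence "(g ^ k = 1) \<longleftrightarrow> (CARD('a) - 1) dvd k" for k
    using mod[OF g1, of k] le[of "k mod (CARD('a) - 1)"]
    by (cases "k mod (CARD('a) - 1) = 0") (auto simp: dvd_eq_mod_eq_0 simp flip: not_less)
  with g gen show ?thesis by (rule that)
qed

lemma CHAR_finite_field: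
  assumes "CARD('a :: {field, finite}) = p ^ n" "prime p"
  shows "CHAR('a) = p"
proof -
  have "prime CHAR('a)"
    by (intro prime_CHAR_semidom finite_imp_CHAR_pos) simp
  moreover have "CHAR('a) dvd p ^ n"
    using CHAR_dvd_CARD[where ?'a = 'a] assms by simp
  ultimately show ?thesis
    using assms(2) prime_dvd_power primes_dvd_imp_eq by blast
qed

section \<open>Integer polynomials in characteristic p and embeddings of finite fields\<close>

lemma map_poly_of_int_add:
  "map_poly of_int (f + g) = (map_poly of_int f + map_poly of_int g :: 'a :: comm_ring_1 poly)"
  by (rule poly_eqI) (simp add: coeff_map_poly)

lemma map_poly_of_int_minus:
  "map_poly of_int (f - g) = (map_poly of_int f - map_poly of_int g :: 'a :: comm_ring_1 poly)"
  by (rule poly_eqI) (simp add: coeff_map_poly)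

lemma map_poly_of_int_mult:
  "map_poly of_int (f * g) = (map_poly of_int f * map_poly of_int g :: 'a :: comm_ring_1 poly)"
  by (rule poly_eqI) (simp add: coeff_map_poly coeff_mult)

lemma map_poly_of_int_monom:
  "map_poly of_int (monom c n) = (monom (of_int c) n :: 'a :: comm_ring_1 poly)"
  by (rule poly_eqI) (simp add: coeff_map_poly)

text \<open>Integer coefficients allow one and the same polynomial to be evaluated in both fields
  \<open>'a\<close> and \<open>'b\<close>.\<close>

definition int_poly_eval :: "'a :: comm_ring_1 \<Rightarrow> int poly \<Rightarrow> 'a" where
  "int_poly_eval x f = poly (map_poly of_int f) x"

lemma int_poly_eval_simps:
  "int_poly_eval x (f + g) = int_poly_eval x f + int_poly_eval x g"
  "int_poly_eval x (f - g) = int_poly_eval x f - int_poly_eval x g"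
  "int_poly_eval x (f * g) = int_poly_eval x f * int_poly_eval x g"
  "int_poly_eval x (monom c n) = of_int c * x ^ n"
  "int_poly_eval x 0 = 0"
  "int_poly_eval x 1 = 1"
  by (simp_all add: int_poly_eval_def map_poly_of_int_add map_poly_of_int_minus
        map_poly_of_int_mult map_poly_of_int_monom poly_monom)

text \<open>Modulo \<open>p\<close> the highest surviving coefficient is invertible, so
  \<open>r\<close> can be normalized to a monic polynomial. This is what contradicts the minimal
  degree of a monic polynomial when a remainder does not vanish modulo \<open>p\<close>.\<close>

lemma int_poly_eval_monic_reduct:
  fixes x :: "'a :: comm_ring_1"
  assumes "CHAR('a) = p" "prime p" "int_poly_eval x r = 0" "\<exists>j. \<not> int p dvd coeff r j"
  obtains t where "lead_coeff t = 1" "int_poly_eval x t = 0" "degree t \<le> degree r"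
proof -
  \<comment> \<open>\<open>n\<close> is the degree of \<open>r\<close> modulo \<open>p\<close>,
    which may be smaller than \<open>degree r\<close>.\<close>
  define n where "n = Max {j. \<not> int p dvd coeff r j}"
  have sub: "{j. \<not> int p dvd coeff r j} \<subseteq> {..degree r}"
    using coeff_eq_0 by (force simp: not_le[symmetric])
  hence fin: "finite {j. \<not> int p dvd coeff r j}"
    using finite_subset by blast
  have n: "\<not> int p dvd coeff r n"
    using Max_in[OF fin] assms(4) by (auto simp: n_def)
  have above: "int p dvd coeff r j" if "j > n" for j
    using Max_ge[OF fin, of j] that by (force simp: n_def)
  have "coprime (coeff r n) (int p)"
    using n assms(2) by (metis coprime_commute prime_imp_coprime prime_int_nat_transfer prime_nat_int_transfer)
  then obtain u where u: "[coeff r n * u = 1] (mod int p)"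
    using cong_solve_coprime_int by blast
  \<comment> \<open>After scaling by \<open>u\<close>, replacing all terms from \<open>n\<close>
    upwards by X^n changes coefficients only by multiples of \<open>p\<close>.\<close>
  define t where "t = poly_cutoff n (smult u r) + monom 1 n"
  have coeff_t: "coeff t j = (if j < n then u * coeff r j else if j = n then 1 else 0)" for j
    by (auto simp: t_def coeff_poly_cutoff)
  have deg: "degree t = n"
    by (rule order.antisym[OF degree_le le_degree]) (auto simp: coeff_t)
  have "map_poly of_int t = (map_poly of_int (smult u r) :: 'a poly)"
  proof (rule poly_eqI)
    fix j
    have "of_int (coeff t j) = (of_int (u * coeff r j) :: 'a)"
      using u above[of j] assms(1) unfolding of_int_eq_iff_cong_CHAR
      by (cases j n rule: linorder_cases)
         (auto simp: coeff_t cong_sym_eq mult.commute cong_iff_dvd_diff)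
    thus "coeff (map_poly of_int t) j = coeff (map_poly of_int (smult u r) :: 'a poly) j"
      by (simp add: coeff_map_poly)
  qed
  also have "\<dots> = smult (of_int u) (map_poly of_int r)"
    by (rule poly_eqI) (simp add: coeff_map_poly)
  finally have "int_poly_eval x t = 0"
    using assms(3) by (simp add: int_poly_eval_def)
  moreover have "n \<le> degree r" using n sub by auto
  ultimately show ?thesis
    by (intro that[of t]) (simp_all add: deg coeff_t)
qed

text \<open>The upper bound counts roots of X^q - X. For the lower bound, a generator
  \<open>g\<close> has order (q + 1)(q - 1), so the powers of \<open>g ^ (q + 1)\<close> give q - 1
  distinct fixed points besides 0.\<close>

lemma card_fixed_points_power:
  assumes "CARD('a :: {field, finite}) = q ^ 2" "q > 1"
  shows "card {x :: 'a. x ^ q = x} = q"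
proof (rule order.antisym)
  define P :: "'a poly" where "P = monom 1 q - monom 1 1"
  have coeff_P: "coeff P q = 1"
    using assms(2) by (simp add: P_def)
  hence "P \<noteq> 0" by auto
  have "degree P \<le> q"
    unfolding P_def using assms(2) by (intro degree_diff_le) (simp_all add: degree_monom_eq)
  moreover have "{x. poly P x = 0} = {x. x ^ q = x}"
    by (auto simp: P_def poly_monom)
  ultimately show "card {x :: 'a. x ^ q = x} \<le> q"
    using card_poly_roots_bound[OF \<open>P \<noteq> 0\<close>] by simp
next
  obtain g :: 'a where g: "g \<noteq> 0" and ord: "\<And>k. g ^ k = 1 \<longleftrightarrow> (CARD('a) - 1) dvd k"
    using finite_field_generator by metis
  have fac: "CARD('a) - 1 = (q + 1) * (q - 1)"
    using assms by (simp add: power2_eq_square algebra_simps)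
  define e where "e = (\<lambda>k. g ^ ((q + 1) * k))"
  have less: "e k \<noteq> e l" if "k < l" "l < q - 1" for k l
  proof
    assume "e k = e l"
    moreover have "(q + 1) * l = (q + 1) * k + (q + 1) * (l - k)"
      using that by (simp only: distrib_left[symmetric]) simp
    hence "e l = e k * g ^ ((q + 1) * (l - k))"
      unfolding e_def by (metis power_add)
    ultimately have "g ^ ((q + 1) * (l - k)) = 1"
      using g by (simp add: e_def)
    hence "(q + 1) * (q - 1) dvd (q + 1) * (l - k)"
      using ord fac by simp
    hence "(q - 1) dvd (l - k)" by (simp only: dvd_mult_cancel1 nat_mult_dvd_cancel_disj) simp
    thus False using that by (auto dest: dvd_imp_le)
  qed
  have inj: "inj_on e {..<q - 1}"
    by (rule inj_onI) (metis less lessThan_iff linorder_neqE_nat)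
  have fixed: "e k ^ q = e k" for k
  proof -
    have "e k ^ q = e k ^ (q - 1) * e k"
      using assms(2) by (metis power_minus_mult less_trans zero_less_one)
    moreover have "e k ^ (q - 1) = g ^ ((CARD('a) - 1) * k)"
      unfolding e_def power_mult[symmetric] fac by (simp only: mult_ac)
    ultimately show ?thesis using ord[of "(CARD('a) - 1) * k"] by simp
  qed
  have "q = card (insert 0 (e ` {..<q - 1}))"
    using assms(2) g card_image[OF inj] by (subst card_insert_disjoint) (auto simp: e_def)
  also have "\<dots> \<le> card {x :: 'a. x ^ q = x}"
    using fixed assms(2) by (intro card_mono) auto
  finally show "q \<le> card {x :: 'a. x ^ q = x}" .
qed

text \<open>With n = \<open>CARD('b)\<close>, the hypothesis \<open>card\<close> says that X^n - X
  has as many roots in \<open>'a\<close> as its degree allows. Hence its nonconstant factors have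
  roots there too, in particular the minimal polynomial of a generator of \<open>'b\<close>.\<close>

lemma finite_field_embedding:
  assumes "CHAR('a :: {field, finite}) = p" "CHAR('b :: {field, finite}) = p" "prime p"
    and card: "CARD('b) \<le> card {x :: 'a. x ^ CARD('b) = x}"
  obtains \<psi> :: "'b :: {field, finite} \<Rightarrow> 'a :: {field, finite}"
  where "\<And>x y. \<psi> (x + y) = \<psi> x + \<psi> y" "\<And>x y. \<psi> (x * y) = \<psi> x * \<psi> y" "\<psi> 1 = 1"
proof -
  define n where "n = CARD('b)"
  have n1: "n > 1"
    using card_mono[of UNIV "{0, 1 :: 'b}"] by (simp add: n_def)
  obtain g :: 'b where gen: "\<And>x. x \<noteq> 0 \<Longrightarrow> \<exists>k. x = g ^ k"
    using finite_field_generator by metis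
  define P :: "int poly" where "P = monom 1 n - monom 1 1"
  have deg_P: "degree P = n"
    by (rule order.antisym[OF degree_le le_degree]) (use n1 in \<open>auto simp: P_def\<close>)
  have lead_P: "lead_coeff P = 1"
    unfolding deg_P using n1 by (simp add: P_def)
  have eval_P: "int_poly_eval x P = x ^ n - x" for x :: "'c :: comm_ring_1"
    by (simp add: P_def int_poly_eval_simps)
  define Q where "Q = (\<lambda>f :: int poly. lead_coeff f = 1 \<and> int_poly_eval g f = 0)"
  have "Q P"
    using lead_P eval_P[of g] finite_field_power_card[of g] by (simp add: Q_def n_def)
  \<comment> \<open>\<open>f\<close> plays the minimal polynomial of \<open>g\<close>;
    \<open>P\<close> shows that candidates exist.\<close>
  then obtain f where "Q f" and min: "\<And>t. Q t \<Longrightarrow> degree f \<le> degree t"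
    using ex_has_least_nat[of Q P degree] by blast
  hence monic: "lead_coeff f = 1" and root: "int_poly_eval g f = 0"
    by (simp_all add: Q_def)
  hence "f \<noteq> 0" by auto
  have deg_f: "degree f > 0"
  proof (rule ccontr)
    assume "\<not> degree f > 0"
    hence "f = 1"
      using monic by (auto elim!: degree_eq_zeroE)
    thus False using root by (simp add: int_poly_eval_simps)
  qed
  \<comment> \<open>Pseudo-division by the monic \<open>f\<close> is genuine division. The remainder
    vanishes at \<open>g\<close>, so by minimality of \<open>f\<close> all its coefficients are
    divisible by \<open>p\<close>, and it disappears in \<open>'a\<close>.\<close>
  have key: "\<exists>s. map_poly of_int t = (map_poly of_int f * map_poly of_int s :: 'a poly)"
    if "int_poly_eval g t = 0" for t
  proof -
    obtain s r where sr: "pseudo_divmod t f = (s, r)" by force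
    have t: "t = f * s + r" and deg: "r = 0 \<or> degree r < degree f"
      using pseudo_divmod[OF \<open>f \<noteq> 0\<close> sr] monic by simp_all
    have "int_poly_eval g r = 0"
      using that root by (simp add: t int_poly_eval_simps)
    hence "int p dvd coeff r j" for j
    proof (rule_tac ccontr)
      assume r0: "int_poly_eval g r = 0" and "\<not> int p dvd coeff r j"
      then obtain u where "lead_coeff u = 1" "int_poly_eval g u = 0" "degree u \<le> degree r"
        using int_poly_eval_monic_reduct[OF assms(2,3) r0] by blast
      moreover have "r \<noteq> 0" using \<open>\<not> int p dvd coeff r j\<close> by auto
      ultimately show False using min[of u] deg by (simp add: Q_def)
    qed
    hence "map_poly of_int r = (0 :: 'a poly)"
      using assms(1) by (intro poly_eqI) (simp add: coeff_map_poly of_int_eq_0_iff_char_dvd)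
    thus ?thesis by (auto simp: t map_poly_of_int_add map_poly_of_int_mult)
  qed
  obtain s where s: "map_poly of_int P = (map_poly of_int f * map_poly of_int s :: 'a poly)"
    using key[of P] \<open>Q P\<close> by (auto simp: Q_def)
  have deg_map: "degree (map_poly of_int t :: 'a poly) = degree t" if "lead_coeff t = 1" for t
    by (rule map_poly_degree_eq) (simp add: that)
  have nz: "map_poly of_int P \<noteq> (0 :: 'a poly)"
    using deg_map[OF lead_P] deg_P n1 by auto
  \<comment> \<open>If \<open>f\<close> had no root in \<open>'a\<close>, all roots of X^n - X would
    be roots of the cofactor \<open>s\<close>, whose degree is below n.\<close>
  have "\<exists>h :: 'a. int_poly_eval h f = 0"
  proof (rule ccontr)
    assume no: "\<nexists>h :: 'a. int_poly_eval h f = 0"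
    have "x ^ n - x = int_poly_eval x f * int_poly_eval x s" for x :: 'a
      unfolding eval_P[symmetric] by (simp add: int_poly_eval_def s)
    hence "{x :: 'a. x ^ n = x} \<subseteq> {x. poly (map_poly of_int s) x = 0}"
      using no unfolding int_poly_eval_def[symmetric]
      by (metis (mono_tags, lifting) Collect_mono diff_self mult_eq_0_iff)
    hence "card {x :: 'a. x ^ n = x} \<le> card {x :: 'a. poly (map_poly of_int s) x = 0}"
      by (intro card_mono) simp_all
    also have "\<dots> \<le> degree (map_poly of_int s :: 'a poly)"
      using nz s by (intro card_poly_roots_bound) auto
    also have "\<dots> < n"
      using deg_f deg_map[OF monic] deg_map[OF lead_P] nz s deg_P by (simp add: degree_mult_eq)
    finally show False using card by (simp add: n_def)
  qed
  then obtain h :: 'a where h: "int_poly_eval h f = 0" by blast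
  have vanish: "int_poly_eval h t = 0" if "int_poly_eval g t = 0" for t
    using key[OF that] h by (auto simp: int_poly_eval_def)
  \<comment> \<open>Any integer polynomial with value \<open>x\<close> at \<open>g\<close> will do,
    since \<open>vanish\<close> makes the value at \<open>h\<close> independent of the
    choice.\<close>
  define rep where "rep = (\<lambda>x. SOME t. int_poly_eval g t = x)"
  define \<psi> where "\<psi> = (\<lambda>x. int_poly_eval h (rep x))"
  have rep: "int_poly_eval g (rep x) = x" for x
    unfolding rep_def
  proof (rule someI_ex)
    show "\<exists>t. int_poly_eval g t = x"
    proof (cases "x = 0")
      case True
      thus ?thesis by (intro exI[of _ 0]) (simp add: int_poly_eval_simps)
    next
      case False
      then obtain k where "x = g ^ k" using gen by blast
      thus ?thesis by (intro exI[of _ "monom 1 k"]) (simp add: int_poly_eval_simps)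
    qed
  qed
  have \<psi>: "\<psi> (int_poly_eval g t) = int_poly_eval h t" for t
    using vanish[of "rep (int_poly_eval g t) - t"]
    by (simp add: \<psi>_def int_poly_eval_simps rep)
  show ?thesis
  proof (rule that[of \<psi>])
    show "\<psi> (x + y) = \<psi> x + \<psi> y" "\<psi> (x * y) = \<psi> x * \<psi> y" for x y
      using \<psi>[of "rep x + rep y"] \<psi>[of "rep x * rep y"]
      by (simp_all add: int_poly_eval_simps rep \<psi>_def)
    show "\<psi> 1 = 1"
      using \<psi>[of 1] by (simp add: int_poly_eval_simps)
  qed
qed

section \<open>Squares and fixed points of Frobenius powers\<close>

lemma two_neq_0_if_odd_CHAR:
  assumes "odd CHAR('a :: {ring_1, zero_neq_one})"
  shows "(2 :: 'a) \<noteq> 0"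
proof
  assume "(2 :: 'a) = 0"
  hence "CHAR('a) dvd 2"
    using of_nat_eq_0_iff_char_dvd[of 2, where ?'a = 'a] by simp
  hence "CHAR('a) = 1 \<or> CHAR('a) = 2"
    using two_is_prime_nat unfolding prime_nat_iff by blast
  thus False using assms CHAR_not_1[where ?'a = 'a] by auto
qed

text \<open>Squaring identifies 1 and -1, so on a finite field it is not surjective either.\<close>

lemma nonsquare_exists:
  assumes "odd CHAR('a :: {field, finite})"
  obtains \<alpha> :: "'a :: {field, finite}" where "\<nexists>\<beta>. \<alpha> = \<beta> ^ 2"
proof -
  have "(1 :: 'a) \<noteq> - 1"
    using two_neq_0_if_odd_CHAR[OF assms] by (metis add.right_inverse one_add_one)
  hence "\<not> inj (\<lambda>x :: 'a. x ^ 2)" by (auto dest: injD[of _ 1 "- 1"])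
  hence "\<not> surj (\<lambda>x :: 'a. x ^ 2)" using finite_UNIV_surj_inj[OF finite] by blast
  thus ?thesis using that by (auto simp: surj_def)
qed

text \<open>The elements of the subfield of order \<open>q\<close> become squares in its quadratic
  extension: a nonzero one is a power of the generator whose exponent is divisible by the even
  number q + 1.\<close>

lemma fixed_point_power_is_square:
  fixes c :: "'a :: {field, finite}"
  assumes "CARD('a) = q ^ 2" "odd q" "q > 1" "c ^ q = c"
  obtains w where "w ^ 2 = c"
proof (cases "c = 0")
  case True
  thus ?thesis using that[of 0] by simp
next
  case False
  obtain g :: 'a where gen: "\<And>x. x \<noteq> 0 \<Longrightarrow> \<exists>k. x = g ^ k"
    and ord: "\<And>k. g ^ k = 1 \<longleftrightarrow> (CARD('a) - 1) dvd k"
    using finite_field_generator by metis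
  obtain k where k: "c = g ^ k" using gen[OF False] by blast
  have "c ^ q = c ^ (q - 1) * c"
    using assms(3) by (metis power_minus_mult less_trans zero_less_one)
  hence "c ^ (q - 1) = 1" using assms(4) False by simp
  hence "(CARD('a) - 1) dvd k * (q - 1)" using ord[of "k * (q - 1)"] by (simp add: k power_mult)
  moreover have "CARD('a) - 1 = (q + 1) * (q - 1)"
    using assms by (simp add: power2_eq_square algebra_simps)
  ultimately have "(q + 1) * (q - 1) dvd k * (q - 1)" by (simp only:)
  hence "(q + 1) dvd k" using assms(3)
    by (simp only: nat_mult_dvd_cancel_disj mult.commute[of _ "q - 1"]) simp
  hence "even k" using assms(2) by (meson dvd_trans even_plus_one_iff)
  hence "(g ^ (k div 2)) ^ 2 = c" by (simp add: k flip: power_mult)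
  thus ?thesis by (rule that)
qed

text \<open>By Bezout over the naturals, a multiple of \<open>a\<close> exceeds a multiple of
  \<open>b\<close> by the gcd, and both multiples give iterates that fix \<open>x\<close>.\<close>

lemma power_prime_power_fixed_gcd:
  fixes x :: "'a :: monoid_mult"
  assumes "x ^ (p ^ a) = x" "x ^ (p ^ b) = x" "a \<noteq> 0"
  shows "x ^ (p ^ gcd a b) = x"
proof -
  have iter: "x ^ (p ^ (c * k)) = x" if "x ^ (p ^ c) = x" for c k
    by (induction k) (simp_all add: power_add power_mult that)
  obtain u v where "a * u = b * v + gcd a b"
    using bezout_nat[OF assms(3)] by blast
  hence "x ^ (p ^ (a * u)) = (x ^ (p ^ (b * v))) ^ (p ^ gcd a b)"
    by (simp add: power_add power_mult)
  thus ?thesis using iter assms(1,2) by simp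
qed

section \<open>Additive maps, isotopy and planarity\<close>

lemma additive_zero:
  fixes L :: "'a :: ab_group_add \<Rightarrow> 'b :: ab_group_add"
  assumes "\<And>x y. L (x + y) = L x + L y"
  shows "L 0 = 0"
  using assms[of 0 0] by simp

lemma prime_field_linear_iff_additive:
  "prime_field_linear L \<longleftrightarrow> (\<forall>x y. L (x + y) = L x + L y)"
proof
  assume add: "\<forall>x y. L (x + y) = L x + L y"
  hence "L (prime_field_scale k x) = prime_field_scale k (L x)" for k x
    by (induction k) (simp_all add: prime_field_scale_def additive_zero)
  with add show "prime_field_linear L" by (simp add: prime_field_linear_def)
qed (simp add: prime_field_linear_def)

lemma additive_bijI:
  fixes f :: "'a :: {ab_group_add, finite} \<Rightarrow> 'b :: {ab_group_add, finite}"
  assumes add: "\<And>x y. f (x + y) = f x + f y" and ker: "\<And>x. f x = 0 \<Longrightarrow> x = 0"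
    and "CARD('a) = CARD('b)"
  shows "bij f"
proof -
  have "inj f"
  proof (rule injI)
    fix x y assume "f x = f y"
    moreover have "f x = f (x - y) + f y" using add[of "x - y" y] by simp
    ultimately show "x = y" using ker[of "x - y"] by simp
  qed
  moreover have "range f = UNIV"
    using assms(3) card_image[OF \<open>inj f\<close>] by (intro card_subset_eq) simp_all
  ultimately show ?thesis by (simp add: bij_def)
qed

lemma additive_inv:
  assumes "\<And>x y. f (x + y) = f x + f y" "bij f"
  shows "inv_into UNIV f (x + y) = inv_into UNIV f x + inv_into UNIV f y"
  using assms by (metis bij_inv_eq_iff)

text \<open>This yields biadditivity of \<open>planar_star F\<close>, as well as the absence of zero
  divisors, without expanding the powers in \<open>F\<close>.\<close>

lemma isotopic_presemifield:
  assumes "isotopic s t" "presemifield t"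
  shows "presemifield s"
proof -
  from assms(1) obtain L M N where
    L: "\<And>x y. L (x + y) = L x + L y" "bij L" and
    M: "\<And>x y. M (x + y) = M x + M y" "bij M" and
    N: "\<And>x y. N (x + y) = N x + N y" "bij N" and
    iso: "\<And>x y. L (s x y) = t (M x) (N y)"
    unfolding isotopic_def prime_field_linear_iff_additive by blast
  have inj: "L x = L y \<longleftrightarrow> x = y" "M x = M y \<longleftrightarrow> x = y" "N x = N y \<longleftrightarrow> x = y" for x y
    using L(2) M(2) N(2) by (simp_all add: bij_def inj_eq)
  have t: "t x (y + z) = t x y + t x z" "t (x + y) z = t x z + t y z"
    "t x y = 0 \<Longrightarrow> x = 0 \<or> y = 0" for x y z
    using assms(2) by (simp_all add: presemifield_def)
  show ?thesis
    unfolding presemifield_def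
  proof (intro conjI allI impI)
    show "s x (y + z) = s x y + s x z" "s (x + y) z = s x z + s y z" for x y z
      by (simp_all add: inj(1)[symmetric] L M N iso t)
    fix x y assume "s x y = 0"
    hence "M x = 0 \<or> N y = 0" using iso[of x y] additive_zero[of L] L t by simp
    thus "x = 0 \<or> y = 0"
      using inj(2)[of x 0] inj(3)[of y 0] additive_zero[of M] additive_zero[of N] M N by simp
  qed
qed

text \<open>Up to the constant \<open>F a\<close>, the difference map is
  \<open>planar_star F x a\<close>, which is additive in \<open>x\<close> with trivial
  kernel.\<close>

lemma planar_if_presemifield:
  fixes F :: "'a :: {field, finite} \<Rightarrow> 'a"
  assumes "presemifield (planar_star F)"
  shows "planar F"
  unfolding planar_def
proof (intro allI impI)
  fix a :: 'a assume "a \<noteq> 0"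
  have "inj (\<lambda>x. F (x + a) - F x)"
  proof (rule injI)
    fix x y assume "F (x + a) - F x = F (y + a) - F y"
    hence "planar_star F x a = planar_star F y a"
      by (simp add: planar_star_def)
    moreover have "planar_star F ((x - y) + y) a = planar_star F (x - y) a + planar_star F y a"
      using assms by (simp only: presemifield_def)
    ultimately have "planar_star F (x - y) a = 0" by simp
    hence "x - y = 0 \<or> a = 0" using assms by (simp only: presemifield_def)
    thus "x = y" using \<open>a \<noteq> 0\<close> by simp
  qed
  thus "bij (\<lambda>x. F (x + a) - F x)"
    by (simp add: bij_def finite_UNIV_inj_surj)
qed

section \<open>Dickson's semifield\<close>

text \<open>A zero divisor would exhibit \<alpha> as a square: eliminating \<open>a\<close> leaves
  \<alpha> times an odd power of \<open>b * d\<close> equal to \<open>b * c^2 / d\<close>. The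
  identity element is \<open>(1, 0)\<close>.\<close>

lemma commutative_semifield_dickson:
  fixes \<alpha> :: "'b :: field"
  assumes "CHAR('b) = p" "prime p" "odd p" and nonsq: "\<nexists>\<beta>. \<alpha> = \<beta> ^ 2"
  shows "commutative_semifield (dickson_star p i \<alpha>)"
proof -
  have frob: "(x + y) ^ (p ^ i) = x ^ (p ^ i) + y ^ (p ^ i)" for x y :: 'b
    using assms(1,2) by (intro freshmans_dream') auto
  have zero: "a = 0 \<and> b = 0 \<or> c = 0 \<and> d = 0"
    if 1: "a * c + \<alpha> * (b * d) ^ (p ^ i) = 0" and 2: "a * d + b * c = 0" for a b c d :: 'b
  proof (rule ccontr)
    assume nz: "\<not> ?thesis"
    have p: "p ^ i > 0" using assms(3) by (simp add: odd_pos)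
    have d: "d \<noteq> 0" using nz 1 2 p by (auto simp: power_0_left)
    have a: "a = - (b * c / d)" using 2 d by (simp add: field_simps eq_neg_iff_add_eq_0)
    have b: "b \<noteq> 0" using nz a by auto
    \<comment> \<open>As \<open>p ^ i\<close> is odd, \<open>(b * d) ^ (p ^ i)\<close> is
      \<open>b * d\<close> times the square of \<open>e\<close>.\<close>
    define e where "e = (b * d) ^ ((p ^ i - 1) div 2)"
    have e: "e \<noteq> 0" using b d by (simp add: e_def)
    have "even (p ^ i - 1)" using assms(3) by simp
    hence "p ^ i = Suc (2 * ((p ^ i - 1) div 2))" using p by simp
    hence pow: "(b * d) ^ (p ^ i) = b * d * e ^ 2"
      unfolding e_def by (metis power_Suc power_mult mult.commute)
    have "\<alpha> * (b * d * e ^ 2) = b * c / d * c"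
      using 1 unfolding pow a by (simp add: algebra_simps)
    hence "\<alpha> = (c / (d * e)) ^ 2"
      using b d e by (simp add: field_simps power2_eq_square)
    thus False using nonsq by blast
  qed
  show ?thesis
    unfolding commutative_semifield_def commutative_presemifield_def presemifield_def
  proof (intro conjI allI impI exI[of _ "(1, 0)"])
    fix x y :: "'b \<times> 'b" assume "dickson_star p i \<alpha> x y = 0"
    thus "x = 0 \<or> y = 0"
      using zero[of "fst x" "fst y" "snd x" "snd y"]
      by (auto simp: dickson_star_def zero_prod_def split: prod.splits)
  qed (use assms(3) in \<open>auto simp: dickson_star_def zero_prod_def frob algebra_simps odd_pos
        split: prod.splits\<close>)
qed

section \<open>The isotopy with Dickson's semifield\<close>

lemma planar_star_isotopic_dickson:
  fixes p m i q :: nat and \<alpha> :: "'b :: {field, finite}" and G :: "'a :: {field, finite} \<Rightarrow> 'a"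
  assumes "prime p" and "odd p" and "q = p ^ m" and "0 < i" and "m > 0"
    and cardA: "CARD('a) = q ^ 2" and cardB: "CARD('b) = p ^ m"
    and gcd: "gcd i m = gcd i (2 * m)"
    and G: "\<And>x. G x = x ^ 2 + x ^ (q + 1) - x ^ ((q + 1) * p ^ i) + x ^ (2 * q * p ^ i)"
    and nonsq: "\<nexists>\<beta>. \<alpha> = \<beta> ^ 2"
  shows "isotopic (planar_star G) (dickson_star p i \<alpha>)"
proof -
  define s where "s = p ^ i"
  have charA: "CHAR('a) = p"
    using cardA assms(1,3) by (intro CHAR_finite_field[of p "m * 2"]) (simp_all add: power_mult)
  have charB: "CHAR('b) = p"
    using cardB assms(1) by (rule CHAR_finite_field)
  have q1: "q > 1"
    using assms(1,3,5) prime_gt_1_nat one_less_power by blast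
  have odd: "odd q" "odd s" using assms(2,3) by (simp_all add: s_def)
  have frob_s: "(x + y) ^ s = x ^ s + y ^ s" for x y :: 'a
    using charA assms(1) by (intro freshmans_dream'[of _ i]) (auto simp: s_def)
  have frob_s_B: "(x + y) ^ s = x ^ s + y ^ s" for x y :: 'b
    using charB assms(1) by (intro freshmans_dream'[of _ i]) (auto simp: s_def)
  have frob_q: "(x + y) ^ q = x ^ q + y ^ q" for x y :: 'a
    using charA assms(1,3) by (intro freshmans_dream'[of _ m]) auto
  have two: "(2 :: 'a) \<noteq> 0" "(2 :: 'b) \<noteq> 0"
    using charA charB assms(2) two_neq_0_if_odd_CHAR by metis+
  have neg_eq: "x = 0" if "x = - x" for x :: 'a
  proof -
    have "2 * x = 0" using that by (metis add.right_inverse mult_2)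
    thus ?thesis using two(1) by simp
  qed
  \<comment> \<open>The eigenspaces of the q-th power map for 1 and -1 are independent, because 2 is
    nonzero.\<close>
  have split: "u = 0 \<and> w = 0" if "u ^ q = u" "w ^ q = - w" "u + w = 0" for u w :: 'a
  proof -
    have "u - w = (u + w) ^ q" unfolding frob_q using that(1,2) by simp
    also have "\<dots> = 0" using that(3) q1 by simp
    finally have "u = w" by simp
    hence "2 * w = 0" using that(3) by (metis mult_2)
    hence "w = 0" using two(1) by simp
    thus ?thesis using \<open>u = w\<close> by simp
  qed

  have card_fix: "card {x :: 'a. x ^ q = x} = q"
    using cardA q1 by (rule card_fixed_points_power)
  hence "CARD('b) \<le> card {x :: 'a. x ^ CARD('b) = x}"
    using cardB assms(3) by simp
  then obtain \<psi> :: "'b \<Rightarrow> 'a" where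
    add: "\<And>x y. \<psi> (x + y) = \<psi> x + \<psi> y" and mult: "\<And>x y. \<psi> (x * y) = \<psi> x * \<psi> y"
    and one: "\<psi> 1 = 1"
    by (rule finite_field_embedding[OF charA charB assms(1)]) (rule that, assumption+)
  have zero: "\<psi> 0 = 0" using add by (rule additive_zero)
  have ker: "x = 0" if "\<psi> x = 0" for x
    using that mult[of x "inverse x"] one by (cases "x = 0") auto
  have pow: "\<psi> (x ^ k) = \<psi> x ^ k" for x k
    by (induction k) (simp_all add: one mult)
  have fixed: "\<psi> x ^ q = \<psi> x" for x
    using finite_field_power_card[of x] cardB assms(3) by (simp flip: pow)
  have inj: "inj \<psi>"
  proof (rule injI)
    fix x y assume "\<psi> x = \<psi> y"
    moreover have "\<psi> x = \<psi> (x - y) + \<psi> y" using add[of "x - y" y] by simp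
    ultimately show "x = y" using ker[of "x - y"] by simp
  qed
  \<comment> \<open>The image consists of fixed points and has \<open>q\<close> elements, so it is
    the whole subfield of order \<open>q\<close>.\<close>
  have range: "range \<psi> = {x. x ^ q = x}"
    using fixed card_fix card_image[OF inj] cardB assms(3)
    by (intro card_subset_eq) auto

  \<comment> \<open>The polarized \<open>G\<close> contains an s-th power of \<omega>^2, so
    \<omega>^2 has to be the image of the s-th root \<delta> of \<alpha>. This root is again a
    nonsquare, which keeps \<omega> outside the subfield.\<close>
  have "inj (\<lambda>x :: 'b. x ^ s)"
  proof (rule injI)
    fix x y :: 'b assume "x ^ s = y ^ s"
    hence "(x - y) ^ s = 0" using frob_s_B[of "x - y" y] by simp
    thus "x = y" by simp
  qed
  hence "surj (\<lambda>x :: 'b. x ^ s)" by (simp add: finite_UNIV_inj_surj)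
  then obtain \<delta> where \<delta>: "\<delta> ^ s = \<alpha>" by (metis surjD)
  have nonsq\<delta>: "\<delta> \<noteq> \<beta> ^ 2" for \<beta>
    using nonsq \<delta> by (metis power_mult mult.commute)
  obtain \<omega> where \<omega>: "\<omega> ^ 2 = \<psi> \<delta>"
    using fixed_point_power_is_square[OF cardA odd(1) q1 fixed] by blast
  have "\<omega> ^ q \<noteq> \<omega>"
  proof
    assume "\<omega> ^ q = \<omega>"
    then obtain \<beta> where "\<omega> = \<psi> \<beta>" using range by blast
    hence "\<psi> (\<beta> ^ 2) = \<psi> \<delta>" using \<omega> by (simp add: pow)
    thus False using nonsq\<delta> inj by (metis injD)
  qed
  moreover have "(\<omega> ^ q) ^ 2 = \<omega> ^ 2"
    using fixed[of \<delta>] by (metis \<omega> power_mult mult.commute)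
  ultimately have \<omega>q: "\<omega> ^ q = - \<omega>" by (simp add: power2_eq_iff)
  hence \<omega>0: "\<omega> \<noteq> 0" using \<open>\<omega> ^ q \<noteq> \<omega>\<close> by auto

  have conj: "(\<psi> b * \<omega>) ^ q = - (\<psi> b * \<omega>)" for b
    by (simp add: power_mult_distrib fixed \<omega>q)
  have \<psi>2: "\<psi> (2 * x) = 2 * \<psi> x" for x by (simp only: mult_2 add)
  have \<psi>4: "\<psi> (4 * x) = 4 * \<psi> x" for x
    using \<psi>2[of "2 * x"] \<psi>2[of x] by simp

  \<comment> \<open>\<Phi> assembles an element from its coordinates. In \<Lambda>, the factor 4
    comes from polarizing the doubled squares, and the factor 2 from the doubled mixed
    product.\<close>
  define \<Phi> where "\<Phi> = (\<lambda>(a, b). \<psi> a + \<psi> b * \<omega>)"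
  define \<Lambda> where "\<Lambda> = (\<lambda>(e, f). \<psi> (4 * e) + (\<psi> (2 * f) * \<omega> - (\<psi> (2 * f) * \<omega>) ^ s))"
  have card_eq: "CARD('b \<times> 'b) = CARD('a)"
    using cardA cardB assms(3) by (simp add: power2_eq_square)
  have \<Phi>_add: "\<Phi> (x + y) = \<Phi> x + \<Phi> y" for x y
    by (cases x; cases y) (simp add: \<Phi>_def add algebra_simps)
  have \<Phi>_bij: "bij \<Phi>"
  proof (rule additive_bijI[OF \<Phi>_add _ card_eq])
    fix x assume "\<Phi> x = 0"
    moreover obtain a b where x: "x = (a, b)" by (cases x)
    ultimately have "\<psi> a = 0" "\<psi> b * \<omega> = 0"
      using split[OF fixed[of a] conj[of b]] by (simp_all add: \<Phi>_def)
    thus "x = 0" using ker \<omega>0 by (simp add: x zero_prod_def)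
  qed
  have \<Lambda>_add: "\<Lambda> (x + y) = \<Lambda> x + \<Lambda> y" for x y
    by (cases x; cases y) (simp add: \<Lambda>_def add distrib_left distrib_right frob_s)
  have \<Lambda>_bij: "bij \<Lambda>"
  proof (rule additive_bijI[OF \<Lambda>_add _ card_eq])
    fix x assume "\<Lambda> x = 0"
    moreover obtain e f where x: "x = (e, f)" by (cases x)
    \<comment> \<open>\<open>z\<close> is negated by the q-th power map, and so is
      \<open>z ^ s\<close> because \<open>s\<close> is odd. Hence \<open>t\<close> is negated as
      well, and \<open>split\<close> separates it from the subfield part.\<close>
    define z where "z = \<psi> (2 * f) * \<omega>"
    define t where "t = z - z ^ s"
    have zq: "z ^ q = - z" by (simp add: z_def conj)
    have "(z ^ s) ^ q = (z ^ q) ^ s" by (simp add: mult.commute flip: power_mult)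
    hence zsq: "(z ^ s) ^ q = - (z ^ s)" using odd(2) by (simp add: zq)
    have "z ^ q = t ^ q + (z ^ s) ^ q"
      using frob_q[of t "z ^ s"] by (simp add: t_def)
    hence "t ^ q = - t" by (simp add: zq zsq t_def algebra_simps)
    moreover have "\<psi> (4 * e) + t = 0"
      using \<open>\<Lambda> x = 0\<close> by (simp add: x \<Lambda>_def t_def z_def)
    ultimately have e: "\<psi> (4 * e) = 0" and "t = 0"
      using split[OF fixed[of "4 * e"], of t] by simp_all
    \<comment> \<open>So \<open>z\<close> lies in the subfield of order \<open>p ^ gcd i (2 * m)\<close>, which by the gcd
      condition is contained in the subfield of order \<open>q\<close>.\<close>
    hence "z ^ (p ^ i) = z" by (simp add: t_def s_def)
    moreover have "z ^ (p ^ (2 * m)) = z"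
      using finite_field_power_card[of z] cardA assms(3) by (simp add: mult.commute power_mult)
    ultimately have "z ^ (p ^ gcd i m) = z"
      using power_prime_power_fixed_gcd[of z p i "2 * m"] assms(4) gcd by simp
    obtain k where k: "m = gcd i m * k" by (meson dvd_def gcd_dvd2)
    from \<open>z ^ (p ^ gcd i m) = z\<close> have "z ^ (p ^ (gcd i m * k)) = z" for k
      by (induction k) (simp_all add: power_add power_mult)
    from this[of k] have "z ^ q = z" unfolding k[symmetric] assms(3) .
    hence "z = - z" using zq by metis
    hence "z = 0" by (rule neg_eq)
    hence "\<psi> (2 * f) = 0" using \<omega>0 by (simp add: z_def)
    hence "2 * f = 0" by (rule ker)
    hence "f = 0" using two(2) by simp
    moreover have "e = 0"
    proof -
      have "4 * e = 2 * (2 * e)" by simp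
      thus ?thesis using ker[OF e] two(2) by (metis mult_eq_0_iff)
    qed
    ultimately show "x = 0" by (simp add: x zero_prod_def)
  qed

  \<comment> \<open>Here \<open>x ^ q\<close> is u - w, so the third term of \<open>G\<close>
    contributes -(u^2 - w^2)^s and the last one (u - w)^(2s). The parts (u^2)^s cancel, and those
    with w^2 add up.\<close>
  have G': "G (u + w) = 2 * (u ^ 2 + u * w) + 2 * ((w ^ 2) ^ s - (u * w) ^ s)"
    if "u ^ q = u" "w ^ q = - w" for u w
  proof -
    define x where "x = u + w"
    have xq: "x ^ q = u - w" using that by (simp add: x_def frob_q)
    have minus: "(- y) ^ s = - (y ^ s)" for y :: 'a using odd(2) by simp
    have "x * x ^ q = u ^ 2 + - (w ^ 2)"
      unfolding xq by (simp add: x_def power2_eq_square algebra_simps)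
    hence dist: "(x * x ^ q) ^ s = (u ^ 2) ^ s - (w ^ 2) ^ s"
      by (simp only: frob_s minus) simp
    \<comment> \<open>Doubled terms are written as sums, so that additivity of the s-th power
      applies without evaluating 2^s.\<close>
    have "(x ^ q) ^ 2 = u ^ 2 + (- (u * w) + - (u * w)) + w ^ 2"
      by (simp add: xq power2_eq_square algebra_simps)
    hence sq: "((x ^ q) ^ 2) ^ s = (u ^ 2) ^ s - 2 * (u * w) ^ s + (w ^ 2) ^ s"
      by (simp only: frob_s minus) simp
    have "x ^ ((q + 1) * s) = (x * x ^ q) ^ s" "x ^ (2 * q * s) = ((x ^ q) ^ 2) ^ s"
      by (simp_all only: power_mult mult.commute[of 2 q]) simp
    hence "G x = x ^ 2 + x * x ^ q - (x * x ^ q) ^ s + ((x ^ q) ^ 2) ^ s"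
      by (simp add: G s_def)
    also have "x ^ 2 + x * x ^ q = 2 * (u ^ 2 + u * w)"
      unfolding xq by (simp add: x_def power2_eq_square algebra_simps)
    also note dist
    also note sq
    finally show ?thesis by (simp add: x_def algebra_simps)
  qed

  have star: "planar_star G (\<Phi> x) (\<Phi> y) = \<Lambda> (dickson_star p i \<alpha> x y)" for x y
  proof -
    obtain a b c d where xy: "x = (a, b)" "y = (c, d)" by (cases x; cases y)
    define u w u' w' where uw: "u = \<psi> a" "w = \<psi> b * \<omega>" "u' = \<psi> c" "w' = \<psi> d * \<omega>"
    have q_uw: "u ^ q = u" "w ^ q = - w" "u' ^ q = u'" "w' ^ q = - w'"
      by (simp_all add: uw fixed conj)
    have "\<Phi> x + \<Phi> y = (u + u') + (w + w')"
      by (simp add: \<Phi>_def xy uw)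
    hence 1: "G (\<Phi> x + \<Phi> y) = 2 * ((u + u') ^ 2 + (u + u') * (w + w'))
        + 2 * (((w + w') ^ 2) ^ s - ((u + u') * (w + w')) ^ s)"
      using q_uw by (simp only:) (rule G', simp_all add: frob_q)
    have 2: "G (\<Phi> x) = 2 * (u ^ 2 + u * w) + 2 * ((w ^ 2) ^ s - (u * w) ^ s)"
      "G (\<Phi> y) = 2 * (u' ^ 2 + u' * w') + 2 * ((w' ^ 2) ^ s - (u' * w') ^ s)"
      using G'[of u w] G'[of u' w'] q_uw by (simp_all add: \<Phi>_def xy uw)
    have "(w + w') ^ 2 = w ^ 2 + (w * w' + w * w') + w' ^ 2"
      by (simp add: power2_eq_square algebra_simps)
    hence 3: "((w + w') ^ 2) ^ s = (w ^ 2) ^ s + 2 * (w * w') ^ s + (w' ^ 2) ^ s"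
      by (simp only: frob_s) simp
    have "(u + u') * (w + w') = u * w + (u * w' + u' * w) + u' * w'"
      by (simp add: algebra_simps)
    hence 4: "((u + u') * (w + w')) ^ s = (u * w) ^ s + (u * w' + u' * w) ^ s + (u' * w') ^ s"
      by (simp only: frob_s)
    have "planar_star G (\<Phi> x) (\<Phi> y) =
        4 * (u * u' + (w * w') ^ s) + (2 * (u * w' + u' * w) - 2 * (u * w' + u' * w) ^ s)"
      unfolding planar_star_def 1 2 3 4 by (simp add: power2_eq_square algebra_simps)
    also have "u * u' + (w * w') ^ s = \<psi> (a * c + \<alpha> * (b * d) ^ s)"
    proof -
      \<comment> \<open>The two factors \<omega> combine to \<psi> \<delta>, and the s-th power
        turns \<delta> into \<alpha>.\<close>
      have "w * w' = \<psi> (b * d * \<delta>)"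
        by (simp add: uw mult \<omega>[symmetric] power2_eq_square algebra_simps)
      hence "(w * w') ^ s = \<psi> (\<alpha> * (b * d) ^ s)"
        by (simp add: \<delta>[symmetric] mult.commute power_mult_distrib flip: pow)
      thus ?thesis by (simp add: uw add mult)
    qed
    also have "u * w' + u' * w = \<psi> (a * d + b * c) * \<omega>"
      by (simp add: uw add mult algebra_simps)
    also have "2 * (\<psi> (a * d + b * c) * \<omega>) = \<psi> (2 * (a * d + b * c)) * \<omega>"
      by (simp only: \<psi>2 mult.assoc)
    also have "2 * (\<psi> (a * d + b * c) * \<omega>) ^ s = (\<psi> (2 * (a * d + b * c)) * \<omega>) ^ s"
      by (simp only: add mult_2 distrib_right frob_s)
    finally show ?thesis
      by (simp only: \<Lambda>_def xy dickson_star_def s_def \<psi>4 prod.case)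
  qed

  \<comment> \<open>\<Phi> and \<Lambda> map pairs to \<open>'a\<close>; isotopy asks for the other
    direction, so the inverses serve, that of \<Phi> for both factors.\<close>
  have lin: "prime_field_linear (inv_into UNIV \<Phi>)" "prime_field_linear (inv_into UNIV \<Lambda>)"
    using additive_inv[OF \<Phi>_add \<Phi>_bij] additive_inv[OF \<Lambda>_add \<Lambda>_bij]
    by (simp_all add: prime_field_linear_iff_additive)
  have "inv_into UNIV \<Lambda> (planar_star G x y) =
      dickson_star p i \<alpha> (inv_into UNIV \<Phi> x) (inv_into UNIV \<Phi> y)" for x y
    using star[of "inv_into UNIV \<Phi> x" "inv_into UNIV \<Phi> y"] \<Phi>_bij \<Lambda>_bij
    by (simp add: bij_def surj_f_inv_f inv_f_f)
  thus ?thesis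
    unfolding isotopic_def using lin \<Phi>_bij \<Lambda>_bij bij_imp_bij_inv by blast
qed

section \<open>Dembowski-Ostrom form and conclusion\<close>

lemma DO_poly_add:
  assumes "DO_poly p n f" "DO_poly p n g"
  shows "DO_poly p n (f + g)"
proof -
  obtain \<alpha> \<beta> where f: "f = (\<Sum>j<n. \<Sum>k\<le>j. monom (\<alpha> k j) (p ^ j + p ^ k))"
    and g: "g = (\<Sum>j<n. \<Sum>k\<le>j. monom (\<beta> k j) (p ^ j + p ^ k))"
    using assms unfolding DO_poly_def by blast
  have "f + g = (\<Sum>j<n. \<Sum>k\<le>j. monom (\<alpha> k j + \<beta> k j) (p ^ j + p ^ k))"
    unfolding f g by (simp add: sum.distrib flip: add_monom)
  thus ?thesis unfolding DO_poly_def by (intro exI[of _ "\<lambda>k j. \<alpha> k j + \<beta> k j"])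
qed

lemma DO_poly_monom:
  assumes "k \<le> j" "j < n"
  shows "DO_poly p n (monom c (p ^ j + p ^ k))"
proof -
  have "(\<Sum>l\<le>j'. monom (if l = k \<and> j' = j then c else 0) (p ^ j' + p ^ l))
      = (if j' = j then monom c (p ^ j + p ^ k) else 0)" for j'
  proof (cases "j' = j")
    case True
    have "(\<Sum>l\<le>j. monom (if l = k then c else 0) (p ^ j + p ^ l))
        = (\<Sum>l\<le>j. if l = k then monom c (p ^ j + p ^ k) else 0)"
      by (intro sum.cong) auto
    thus ?thesis using True assms by simp
  qed simp
  hence "monom c (p ^ j + p ^ k)
      = (\<Sum>j'<n. \<Sum>l\<le>j'. monom (if l = k \<and> j' = j then c else 0) (p ^ j' + p ^ l))"
    using assms by simp
  thus ?thesis unfolding DO_poly_def by (intro exI[of _ "\<lambda>l j'. if l = k \<and> j' = j then c else 0"])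
qed

theorem theorem4p3:
  fixes p m i q :: nat
    and F :: "'a :: {field, finite} poly"
  assumes "prime p" and "odd p" and "m \<ge> 2" and "q = p ^ m" and "0 < i" and "i < m"
    and "CARD('a) = q ^ 2" and "CARD('b :: {field, finite}) = p ^ m"
    and "gcd i m = gcd i (2 * m)"
    and "F = monom 1 2 + monom 1 (q + 1) - monom 1 ((q + 1) * p ^ i) + monom 1 (2 * q * p ^ i)"
  shows "DO_poly p (2 * m) F \<and>
         planar (poly F) \<and>
         commutative_presemifield (planar_star (poly F)) \<and>
         (\<forall>\<alpha> :: 'b. (\<nexists>\<beta>. \<alpha> = \<beta> ^ 2) \<longrightarrow>
            commutative_semifield (dickson_star p i \<alpha>) \<and>
            isotopic (planar_star (poly F)) (dickson_star p i \<alpha>))"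
proof -
  \<comment> \<open>Each exponent is a sum of two powers of \<open>p\<close>, and
    \<open>i < m\<close> keeps m + i below 2m.\<close>
  have "F = monom 1 (p ^ 0 + p ^ 0) + monom 1 (p ^ m + p ^ 0)
      + monom (- 1) (p ^ (m + i) + p ^ i) + monom 1 (p ^ (m + i) + p ^ (m + i))"
    unfolding assms(4,10)
    by (simp add: power_add algebra_simps minus_monom[symmetric] numeral_2_eq_2 mult_2)
  moreover have "DO_poly p (2 * m) \<dots>"
    using assms(3,6) by (intro DO_poly_add DO_poly_monom) simp_all
  ultimately have "DO_poly p (2 * m) F" by simp
  moreover have charB: "CHAR('b) = p"
    using assms(8,1) by (rule CHAR_finite_field)
  have dickson: "commutative_semifield (dickson_star p i \<alpha>)" if "\<nexists>\<beta>. \<alpha> = \<beta> ^ 2" for \<alpha> :: 'b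
    using charB assms(1,2) that by (rule commutative_semifield_dickson)
  have iso: "isotopic (planar_star (poly F)) (dickson_star p i \<alpha>)" if "\<nexists>\<beta>. \<alpha> = \<beta> ^ 2" for \<alpha> :: 'b
    using assms that by (intro planar_star_isotopic_dickson[where m = m and q = q])
      (simp_all add: poly_monom)
  \<comment> \<open>Planarity and the presemifield property do not mention \<alpha>, so the isotopy
    for a single nonsquare suffices.\<close>
  obtain \<alpha> :: 'b where \<alpha>: "\<nexists>\<beta>. \<alpha> = \<beta> ^ 2"
    using nonsquare_exists[where ?'a = 'b] charB assms(2) by metis
  have "presemifield (planar_star (poly F))"
    using isotopic_presemifield[OF iso[OF \<alpha>]] dickson[OF \<alpha>]
    by (simp add: commutative_semifield_def commutative_presemifield_def)
  moreover from this have "planar (poly F)"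
    by (rule planar_if_presemifield)
  moreover have "planar_star (poly F) x y = planar_star (poly F) y x" for x y
    by (simp add: planar_star_def add.commute)
  ultimately show ?thesis
    using dickson iso by (simp add: commutative_presemifield_def)
qed

end
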